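(* Let $M$ be a locally-finite map in the hyperbolic plane with exactly one end such that $V(M)$ is a locally finite collection of vertices, and suppose $G\le\mathrm{Isom}(\mathbb{H}^2)$ acts quasi-transitively on $M$. Then there exist a positive integer $m$, a proper vertex colouring $\mathcal{C}:V(M)\to\{1,\dots,m\}$ and a finite index subgroup $T\le G$ such that $\mathcal{C}$ is $T$-invariant, i.e. $\mathcal{C}(tx)=\mathcal{C}(x)$ for all $t\in T$, $x\in V(M)$.
   Context: A map $M$ in a surface $X$ is a (simple, connected, infinite) graph embedded in $X$: vertices are distinct points, edges are curves meeting only at common endpoints, and each face is homeomorphic to an open disc. Locally-finite and number of ends refer to the underlying graph. $V(M)$ is a locally finite collection of vertices if every compact subset contains only finitely many vertices of $M$. $G$ acts on $M$ if each $g\in G$ maps $M$ to itself with $g(V(M))=V(M)$ inducing a graph automorphism; quasi-transitively means finitely many orbits on $V(M)$. A proper vertex colouring gives adjacent vertices distinct colours. *)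

theory Defs
  imports "HOL-Analysis.Analysis"
begin

definition hdisc :: "complex set" where
  "hdisc = ball 0 1"

text \<open>Hyperbolic distance in the Poincare disc model.\<close>
definition hdist :: "complex \<Rightarrow> complex \<Rightarrow> real" where
  "hdist z w = arcosh (1 + 2 * (cmod (z - w))\<^sup>2 / ((1 - (cmod z)\<^sup>2) * (1 - (cmod w)\<^sup>2)))"

text \<open>Isometries of H^2, represented as maps of the complex plane which are
  hyperbolic isometries of the disc onto itself and the identity outside the disc
  (this normalisation makes composition and inverses well defined).\<close>
definition isom_H2 :: "(complex \<Rightarrow> complex) set" where
  "isom_H2 = {f. bij_betw f hdisc hdisc \<and>
                 (\<forall>z\<in>hdisc. \<forall>w\<in>hdisc. hdist (f z) (f w) = hdist z w) \<and>
                 (\<forall>z. z \<notin> hdisc \<longrightarrow> f z = z)}"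

definition isom_subgroup :: "(complex \<Rightarrow> complex) set \<Rightarrow> bool" where
  "isom_subgroup H \<longleftrightarrow> H \<subseteq> isom_H2 \<and> id \<in> H \<and>
     (\<forall>f\<in>H. \<forall>g\<in>H. f \<circ> g \<in> H) \<and> (\<forall>f\<in>H. inv f \<in> H)"

definition finite_index_subgroup ::
  "(complex \<Rightarrow> complex) set \<Rightarrow> (complex \<Rightarrow> complex) set \<Rightarrow> bool" where
  "finite_index_subgroup T G \<longleftrightarrow> isom_subgroup T \<and> T \<subseteq> G \<and>
     finite {(\<lambda>t. g \<circ> t) ` T | g. g \<in> G}"

definition adj :: "complex set set \<Rightarrow> complex \<Rightarrow> complex \<Rightarrow> bool" where
  "adj E u v \<longleftrightarrow> {u, v} \<in> E"

definition simple_graph :: "complex set \<Rightarrow> complex set set \<Rightarrow> bool" where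
  "simple_graph V E \<longleftrightarrow> (\<forall>e\<in>E. \<exists>u v. e = {u, v} \<and> u \<in> V \<and> v \<in> V \<and> u \<noteq> v)"

definition graph_connected :: "complex set \<Rightarrow> complex set set \<Rightarrow> bool" where
  "graph_connected V E \<longleftrightarrow> (\<forall>u\<in>V. \<forall>v\<in>V. (adj E)\<^sup>*\<^sup>* u v)"

definition graph_locally_finite :: "complex set \<Rightarrow> complex set set \<Rightarrow> bool" where
  "graph_locally_finite V E \<longleftrightarrow> (\<forall>v\<in>V. finite {u. {u, v} \<in> E})"

definition is_ray :: "complex set \<Rightarrow> complex set set \<Rightarrow> (nat \<Rightarrow> complex) \<Rightarrow> bool" where
  "is_ray V E r \<longleftrightarrow> inj r \<and> range r \<subseteq> V \<and> (\<forall>i. {r i, r (Suc i)} \<in> E)"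

definition connected_avoiding ::
  "complex set \<Rightarrow> complex set set \<Rightarrow> complex set \<Rightarrow> complex \<Rightarrow> complex \<Rightarrow> bool" where
  "connected_avoiding V E S u v \<longleftrightarrow>
     u \<in> V - S \<and> v \<in> V - S \<and>
     (\<lambda>x y. x \<in> V - S \<and> y \<in> V - S \<and> {x, y} \<in> E)\<^sup>*\<^sup>* u v"

definition rays_equiv ::
  "complex set \<Rightarrow> complex set set \<Rightarrow> (nat \<Rightarrow> complex) \<Rightarrow> (nat \<Rightarrow> complex) \<Rightarrow> bool" where
  "rays_equiv V E r1 r2 \<longleftrightarrow>
     (\<forall>S. finite S \<and> S \<subseteq> V \<longrightarrow> (\<exists>i j. connected_avoiding V E S (r1 i) (r2 j)))"

definition one_ended :: "complex set \<Rightarrow> complex set set \<Rightarrow> bool" where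
  "one_ended V E \<longleftrightarrow> (\<exists>r. is_ray V E r) \<and>
     (\<forall>r1 r2. is_ray V E r1 \<and> is_ray V E r2 \<longrightarrow> rays_equiv V E r1 r2)"

definition drawing ::
  "complex set \<Rightarrow> complex set set \<Rightarrow> (complex set \<Rightarrow> real \<Rightarrow> complex) \<Rightarrow> complex set" where
  "drawing V E \<gamma> = V \<union> (\<Union>e\<in>E. path_image (\<gamma> e))"

definition hyp_map ::
  "complex set \<Rightarrow> complex set set \<Rightarrow> (complex set \<Rightarrow> real \<Rightarrow> complex) \<Rightarrow> bool" where
  "hyp_map V E \<gamma> \<longleftrightarrow>
     V \<subseteq> hdisc \<and> simple_graph V E \<and> infinite V \<and> graph_connected V E \<and>
     (\<forall>e\<in>E. arc (\<gamma> e) \<and> e = {pathstart (\<gamma> e), pathfinish (\<gamma> e)} \<and>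
             path_image (\<gamma> e) \<subseteq> hdisc \<and> path_image (\<gamma> e) \<inter> V = e) \<and>
     (\<forall>e\<in>E. \<forall>e'\<in>E. e \<noteq> e' \<longrightarrow> path_image (\<gamma> e) \<inter> path_image (\<gamma> e') \<subseteq> e \<inter> e') \<and>
     (\<forall>F\<in>components (hdisc - drawing V E \<gamma>). F homeomorphic (ball (0::complex) 1))"

definition locally_finite_points :: "complex set \<Rightarrow> bool" where
  "locally_finite_points V \<longleftrightarrow> (\<forall>K. compact K \<and> K \<subseteq> hdisc \<longrightarrow> finite (K \<inter> V))"

definition acts_on_map ::
  "(complex \<Rightarrow> complex) set \<Rightarrow> complex set \<Rightarrow> complex set set \<Rightarrow>
   (complex set \<Rightarrow> real \<Rightarrow> complex) \<Rightarrow> bool" where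
  "acts_on_map G V E \<gamma> \<longleftrightarrow>
     (\<forall>g\<in>G. g ` drawing V E \<gamma> = drawing V E \<gamma> \<and> g ` V = V \<and>
            (\<forall>u\<in>V. \<forall>v\<in>V. {u, v} \<in> E \<longleftrightarrow> {g u, g v} \<in> E))"

definition quasi_transitive ::
  "(complex \<Rightarrow> complex) set \<Rightarrow> complex set \<Rightarrow> bool" where
  "quasi_transitive G V \<longleftrightarrow> finite {(\<lambda>g. g x) ` G | x. x \<in> V}"

definition proper_colouring ::
  "complex set \<Rightarrow> complex set set \<Rightarrow> nat \<Rightarrow> (complex \<Rightarrow> nat) \<Rightarrow> bool" where
  "proper_colouring V E m C \<longleftrightarrow> C ` V \<subseteq> {1..m} \<and>
     (\<forall>u\<in>V. \<forall>v\<in>V. {u, v} \<in> E \<longrightarrow> C u \<noteq> C v)"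

end

theory Submission
  imports Defs "HOL-Computational_Algebra.Polynomial"
begin

text \<open>It suffices to find a normal subgroup \<open>T\<close> of finite index in \<open>G\<close> whose orbits contain no two
  adjacent vertices: then the \<open>T\<close>-orbits are the colours. By normality only the elements moving one
  of finitely many orbit representatives to a neighbour must be kept out of \<open>T\<close>. On the
  hyperboloid, isometries act linearly, and restricted to the span of the vertices \<open>G\<close> acts by
  matrices; by local finiteness only finitely many matrices belong to elements moving a
  representative to itself, to another representative or to a neighbour. By connectedness these
  elements generate the action, so all entries lie in a finitely generated subring of the reals.
  As in Malcev's theorem, some finite nonzero quotient of this ring keeps finitely many prescribed
  nonzero elements nonzero, and \<open>T\<close> is the corresponding congruence subgroup.\<close>

section \<open>Finite quotients of finitely generated domains\<close>

locale subring =
  fixes A :: "'a::comm_ring_1 set"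
  assumes one_mem: "1 \<in> A"
    and diff_mem: "a \<in> A \<Longrightarrow> b \<in> A \<Longrightarrow> a - b \<in> A"
    and mult_mem: "a \<in> A \<Longrightarrow> b \<in> A \<Longrightarrow> a * b \<in> A"
begin

lemma zero_mem: "0 \<in> A"
  using diff_mem[OF one_mem one_mem] by simp

lemma add_mem: "a \<in> A \<Longrightarrow> b \<in> A \<Longrightarrow> a + b \<in> A"
  using diff_mem[OF _ diff_mem[OF zero_mem], of a b] by simp

lemma power_mem: "a \<in> A \<Longrightarrow> a ^ n \<in> A"
  by (induction n) (auto intro: one_mem mult_mem)

lemma sum_mem: "(\<And>i. i \<in> S \<Longrightarrow> f i \<in> A) \<Longrightarrow> sum f S \<in> A"
  by (induction S rule: infinite_finite_induct) (auto intro: zero_mem add_mem)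

lemma prod_mem: "(\<And>i. i \<in> S \<Longrightarrow> f i \<in> A) \<Longrightarrow> prod f S \<in> A"
  by (induction S rule: infinite_finite_induct) (auto intro: one_mem mult_mem)

lemma of_nat_mem: "of_nat n \<in> A"
  by (induction n) (auto intro: zero_mem one_mem add_mem)

end

locale subring_ideal = subring A for A :: "'a::comm_ring_1 set" +
  fixes I :: "'a set"
  assumes ideal_subset: "I \<subseteq> A"
    and ideal_zero: "0 \<in> I"
    and ideal_diff: "x \<in> I \<Longrightarrow> y \<in> I \<Longrightarrow> x - y \<in> I"
    and ideal_mult: "a \<in> A \<Longrightarrow> x \<in> I \<Longrightarrow> a * x \<in> I"
begin

lemma ideal_mult': "x \<in> I \<Longrightarrow> a \<in> A \<Longrightarrow> x * a \<in> I"
  using ideal_mult by (simp add: mult.commute)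

lemma ideal_add: "x \<in> I \<Longrightarrow> y \<in> I \<Longrightarrow> x + y \<in> I"
  using ideal_diff[OF _ ideal_diff[OF ideal_zero], of x y] by simp

lemma ideal_uminus: "x \<in> I \<Longrightarrow> - x \<in> I"
  using ideal_diff[OF ideal_zero] by simp

lemma ideal_sum: "(\<And>i. i \<in> S \<Longrightarrow> f i \<in> I) \<Longrightarrow> sum f S \<in> I"
  by (induction S rule: infinite_finite_induct) (auto intro: ideal_zero ideal_add)

lemma cong_mult:
  assumes "a - b \<in> I" "c - d \<in> I" "b \<in> A" "c \<in> A"
  shows "a * c - b * d \<in> I"
proof -
  have "a * c - b * d = c * (a - b) + b * (c - d)" by (simp add: algebra_simps)
  then show ?thesis using assms by (auto intro: ideal_add ideal_mult)
qed

lemma cong_power: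
  assumes "a - b \<in> I" "a \<in> A" "b \<in> A"
  shows "a ^ k - b ^ k \<in> I"
proof (induction k)
  case 0 then show ?case by (simp add: ideal_zero)
next
  case (Suc k)
  then show ?case using assms by (auto intro!: cong_mult power_mem)
qed

text \<open>If \<open>c\<close> is invertible modulo \<open>I\<close> and has a power in
  \<open>I\<close>, then \<open>(c * v) ^ k\<close> lies in \<open>I\<close> and is congruent to
  1.\<close>

lemma one_mem_if_unit_power_mem:
  assumes "c * v - 1 \<in> I" "c \<in> A" "v \<in> A" "c ^ k \<in> I"
  shows "1 \<in> I"
proof -
  have "(c * v) ^ k - 1 ^ k \<in> I" using assms by (intro cong_power) (auto intro: mult_mem one_mem)
  moreover have "(c * v) ^ k \<in> I"
    unfolding power_mult_distrib using assms by (auto intro: ideal_mult' power_mem)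
  ultimately have "(c * v) ^ k - ((c * v) ^ k - 1 ^ k) \<in> I" by (rule ideal_diff[rotated])
  then show ?thesis by simp
qed

end

text \<open>Finiteness of the quotient is expressed by finitely many representatives in
  \<open>A\<close>, so no quotient ring is constructed.\<close>

locale finite_index_ideal = subring_ideal A I for A :: "'a::comm_ring_1 set" and I +
  assumes one_notin: "1 \<notin> I"
    and finite_quotient: "\<exists>R. finite R \<and> R \<subseteq> A \<and> (\<forall>a\<in>A. \<exists>r\<in>R. a - r \<in> I)"

text \<open>Asking for a unit rather than just a nonzero residue is what makes the property pass from
  \<open>A\<close> to \<open>A[x]\<close>: it keeps denominators invertible.\<close>

definition units_survive :: "'a::comm_ring_1 set \<Rightarrow> bool" where
  "units_survive A \<longleftrightarrow> subring A \<and>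
     (\<forall>d\<in>A. d \<noteq> 0 \<longrightarrow> (\<exists>I. finite_index_ideal A I \<and> (\<exists>e\<in>A. d * e - 1 \<in> I)))"

section \<open>Polynomials over a subring or an ideal, and the ring A[x]\<close>

definition polys_over :: "'a::comm_ring_1 set \<Rightarrow> 'a poly set" where
  "polys_over S = {p. \<forall>i. coeff p i \<in> S}"

text \<open>As a subset of the ambient ring, A[x] permits an induction over generators without
  change of type.\<close>

definition adjoin :: "'a::comm_ring_1 set \<Rightarrow> 'a \<Rightarrow> 'a set" where
  "adjoin A x = (\<lambda>p. poly p x) ` polys_over A"

context subring_ideal
begin

lemma polys_over_diff: "p \<in> polys_over I \<Longrightarrow> q \<in> polys_over I \<Longrightarrow> p - q \<in> polys_over I"
  by (auto simp: polys_over_def intro: ideal_diff)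

lemma polys_over_add: "p \<in> polys_over I \<Longrightarrow> q \<in> polys_over I \<Longrightarrow> p + q \<in> polys_over I"
  by (auto simp: polys_over_def intro: ideal_add)

lemma polys_over_mult: "p \<in> polys_over A \<Longrightarrow> q \<in> polys_over I \<Longrightarrow> p * q \<in> polys_over I"
  by (auto simp: polys_over_def coeff_mult intro!: ideal_sum ideal_mult)

lemma polys_over_smult: "a \<in> A \<Longrightarrow> q \<in> polys_over I \<Longrightarrow> smult a q \<in> polys_over I"
  by (auto simp: polys_over_def intro!: ideal_mult)

lemma polys_over_monom: "a \<in> I \<Longrightarrow> monom a n \<in> polys_over I"
  by (auto simp: polys_over_def ideal_zero)

lemma polys_over_const: "a \<in> I \<Longrightarrow> [:a:] \<in> polys_over I"
  by (auto simp: polys_over_def ideal_zero coeff_pCons split: nat.split)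

lemma polys_over_zero: "0 \<in> polys_over I"
  by (auto simp: polys_over_def ideal_zero)

lemma polys_over_subset: "polys_over I \<subseteq> polys_over A"
  using ideal_subset by (auto simp: polys_over_def)

end

context subring
begin

text \<open>A ring is an ideal of itself; through \<open>self\<close> the closure facts for
  \<open>polys_over I\<close> also serve \<open>polys_over A\<close>.\<close>

lemma subring_ideal_self: "subring_ideal A A"
  by unfold_locales (auto intro: zero_mem diff_mem mult_mem)

sublocale self: subring_ideal A A
  by (rule subring_ideal_self)

lemma subring_adjoin: "subring (adjoin A x)"
proof
  show "1 \<in> adjoin A x"
    unfolding adjoin_def using self.polys_over_const[OF one_mem] by (intro image_eqI[where x = "[:1:]"]) auto
next
  fix a b assume "a \<in> adjoin A x" "b \<in> adjoin A x"
  then obtain p q where "p \<in> polys_over A" "q \<in> polys_over A" "a = poly p x" "b = poly q x"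
    by (auto simp: adjoin_def)
  then show "a - b \<in> adjoin A x" "a * b \<in> adjoin A x"
    unfolding adjoin_def
    by (auto intro: image_eqI[OF _ self.polys_over_diff, of _ _ p q] image_eqI[OF _ self.polys_over_mult, of _ _ p q])
qed

lemma subset_adjoin: "A \<subseteq> adjoin A x"
proof
  fix a assume "a \<in> A"
  then show "a \<in> adjoin A x"
    unfolding adjoin_def using self.polys_over_const by (intro image_eqI[where x = "[:a:]"]) auto
qed

lemma mem_adjoin: "x \<in> adjoin A x"
  unfolding adjoin_def using self.polys_over_monom[OF one_mem, of 1]
  by (intro image_eqI[where x = "monom 1 1"]) (auto simp: poly_monom)

end

text \<open>The leading term of \<open>f\<close> is cancelled after scaling by the leading
  coefficient of \<open>p\<close> instead of dividing by it. Only multiples of coefficients of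
  \<open>f\<close> by elements of \<open>A\<close>, and their sums, arise, so \<open>g\<close> and
  \<open>r\<close> stay over \<open>I\<close>.\<close>

lemma pseudo_division:
  fixes A :: "'a::idom set"
  assumes "subring_ideal A I" "p \<in> polys_over A" "degree p > 0" "f \<in> polys_over I"
  shows "\<exists>k g r. g \<in> polys_over I \<and> r \<in> polys_over I \<and>
           smult (lead_coeff p ^ k) f = p * g + r \<and> degree r < degree p"
  using assms(4)
proof (induction "degree f" arbitrary: f rule: less_induct)
  case less
  interpret subring_ideal A I by fact
  define c where "c = lead_coeff p"
  have cA: "c \<in> A" using assms(2) by (auto simp: polys_over_def c_def)
  show ?case
  proof (cases "degree f < degree p")
    case True
    then show ?thesis using less.prems polys_over_zero
      by (intro exI[of _ 0] exI[of _ 0] exI[of _ f]) auto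
  next
    case False
    define m where "m = monom (lead_coeff f) (degree f - degree p)"
    have m: "m \<in> polys_over I"
      using less.prems unfolding m_def by (intro polys_over_monom) (auto simp: polys_over_def)
    define f' where "f' = smult c f - p * m"
    have f': "f' \<in> polys_over I"
      unfolding f'_def using m cA assms(2) less.prems
      by (intro polys_over_diff polys_over_smult polys_over_mult)
    have "degree (p * m) \<le> degree f"
      using degree_mult_le[of p m] degree_monom_le[of "lead_coeff f" "degree f - degree p"] False
      unfolding m_def by linarith
    then have le: "degree f' \<le> degree f"
      unfolding f'_def by (intro degree_diff_le) auto
    have "coeff (p * m) (degree f) = c * lead_coeff f"
      using False by (simp add: m_def mult.commute[of p] coeff_monom_mult c_def)
    then have z: "coeff f' (degree f) = 0" by (simp add: f'_def)
    \<comment> \<open>The degree could stay the same only for \<open>f' = 0\<close> and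
      \<open>f\<close> constant, which \<open>0 < degree p \<le> degree f\<close> excludes.\<close>
    have "degree f' < degree f"
    proof (rule ccontr)
      assume "\<not> ?thesis"
      with le have "degree f' = degree f" by simp
      with z have "f' = 0" by (simp flip: leading_coeff_0_iff)
      then show False using \<open>degree f' = degree f\<close> False assms(3) by auto
    qed
    from less.hyps[OF this f'] obtain k g r where
      gr: "g \<in> polys_over I" "r \<in> polys_over I" "smult (c ^ k) f' = p * g + r" "degree r < degree p"
      by (auto simp: c_def)
    have "smult (c ^ Suc k) f = smult (c ^ k) f' + p * smult (c ^ k) m"
      by (simp add: f'_def smult_diff_right mult.commute)
    also have "\<dots> = p * (g + smult (c ^ k) m) + r"
      using gr(3) by (simp add: algebra_simps)
    finally show ?thesis
      using gr(1,2,4) m cA unfolding c_def[symmetric]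
      by (intro exI[of _ "Suc k"] exI[of _ "g + smult (c ^ k) m"] exI[of _ r] conjI
            polys_over_add polys_over_smult power_mem)
  qed
qed

text \<open>Modulo \<open>\<bar>k\<bar> + 1\<close> the integer \<open>k\<close> is congruent to
  \<open>- sgn k\<close>, whose square is 1.\<close>

lemma units_survive_Ints: "units_survive (\<int> :: 'a::{idom, ring_char_0} set)"
  unfolding units_survive_def
proof (intro conjI ballI impI)
  show sub: "subring (\<int> :: 'a set)" by unfold_locales auto
  fix d :: 'a assume "d \<in> \<int>" "d \<noteq> 0"
  then obtain k where k: "d = of_int k" "k \<noteq> 0" by (auto elim: Ints_cases)
  define m where "m = \<bar>k\<bar> + 1"
  have m: "m > 1" using k by (auto simp: m_def)
  define I :: "'a set" where "I = (\<lambda>j. of_int (m * j)) ` UNIV"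
  interpret subring "\<int> :: 'a set" by (fact sub)
  have "finite_index_ideal \<int> I"
  proof
    show "I \<subseteq> \<int>" by (auto simp: I_def)
    show "0 \<in> I" unfolding I_def by (intro image_eqI[of _ _ 0]) auto
    show "x - y \<in> I" if "x \<in> I" "y \<in> I" for x y
    proof -
      from that obtain i j where "x = of_int (m * i)" "y = of_int (m * j)" by (auto simp: I_def)
      then show ?thesis unfolding I_def by (intro image_eqI[of _ _ "i - j"]) (auto simp: algebra_simps)
    qed
    show "a * x \<in> I" if "a \<in> \<int>" "x \<in> I" for a x
    proof -
      from that obtain i j where "a = of_int i" "x = of_int (m * j)" unfolding I_def by (metis Ints_cases imageE)
      then show ?thesis unfolding I_def by (intro image_eqI[of _ _ "i * j"]) (auto simp: algebra_simps)
    qed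
    show "1 \<notin> I"
    proof
      assume "1 \<in> I"
      then obtain j where "of_int 1 = (of_int (m * j) :: 'a)" by (auto simp: I_def)
      then have "1 = m * j" by (simp only: of_int_eq_iff)
      then show False using m by (metis zmult_eq_1_iff less_irrefl not_less_iff_gr_or_eq
            zero_less_one less_trans neg_less_0_iff_less)
    qed
    have "\<exists>r\<in>of_int ` {0..<m}. a - r \<in> I" if "a \<in> \<int>" for a :: 'a
    proof -
      from that obtain i where i: "a = of_int i" by (auto elim: Ints_cases)
      have "a - of_int (i mod m) = of_int (m * (i div m))"
        unfolding i of_int_diff[symmetric] by (simp only: minus_mod_eq_mult_div)
      then show ?thesis using m by (intro bexI[of _ "of_int (i mod m)"]) (auto simp: I_def)
    qed
    then show "\<exists>R. finite R \<and> R \<subseteq> \<int> \<and> (\<forall>a\<in>\<int>. \<exists>r\<in>R. a - r \<in> I)"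
      by (intro exI[of _ "of_int ` {0..<m}"]) auto
  qed
  moreover have "d * of_int (- sgn k) - 1 = of_int (m * (- 1))"
  proof -
    have "k * (- sgn k) - 1 = m * (- 1)" by (simp add: m_def abs_sgn mult.commute)
    then show ?thesis unfolding k(1) by (metis of_int_1 of_int_diff of_int_mult)
  qed
  then have "d * of_int (- sgn k) - 1 \<in> I" unfolding I_def by (rule image_eqI) simp
  ultimately show "\<exists>I. finite_index_ideal \<int> I \<and> (\<exists>e\<in>\<int>. d * e - 1 \<in> I)"
    by (intro exI[of _ I] conjI bexI[of _ "of_int (- sgn k)"]) auto
qed

text \<open>When \<open>x\<close> is transcendental it is specialised to an element of \<open>A\<close> that is not a root.\<close>

lemma units_survive_adjoin_transcendental:
  fixes A :: "'a::{idom, ring_char_0} set"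
  assumes A: "units_survive A" and x: "\<And>p. p \<in> polys_over A \<Longrightarrow> poly p x = 0 \<Longrightarrow> p = 0"
  shows "units_survive (adjoin A x)"
  unfolding units_survive_def
proof (intro conjI ballI impI)
  interpret subring A using A by (auto simp: units_survive_def)
  show sub: "subring (adjoin A x)" by (rule subring_adjoin)
  fix d assume "d \<in> adjoin A x" "d \<noteq> 0"
  then obtain p where p: "p \<in> polys_over A" "d = poly p x" "p \<noteq> 0"
    unfolding adjoin_def by (metis imageE poly_0)
  \<comment> \<open>In characteristic 0 the naturals give infinitely many elements of
    \<open>A\<close>, so some of them is no root of \<open>p\<close>.\<close>
  have "infinite (range (of_nat :: nat \<Rightarrow> 'a))"
    by (intro range_inj_infinite inj_of_nat)
  then have "\<not> range (of_nat :: nat \<Rightarrow> 'a) \<subseteq> {a. poly p a = 0}"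
    using poly_roots_finite[OF p(3)] finite_subset by blast
  then obtain a where a: "a \<in> A" "poly p a \<noteq> 0" using of_nat_mem by auto
  have mem: "poly q a \<in> A" if "q \<in> polys_over A" for q
    using that a(1) unfolding poly_altdef polys_over_def by (auto intro!: sum_mem mult_mem power_mem)
  from A a mem[OF p(1)] obtain I e where I: "finite_index_ideal A I" "e \<in> A" "poly p a * e - 1 \<in> I"
    unfolding units_survive_def by blast
  interpret I: finite_index_ideal A I by (fact I)
  \<comment> \<open>\<open>J\<close> is the preimage of \<open>I\<close> under the map from A[x] to
    \<open>A\<close> specialising \<open>x\<close> to \<open>a\<close>; by transcendence,
    \<open>JI\<close> shows that the choice of polynomial does not matter.\<close>
  define J where "J = (\<lambda>q. poly q x) ` {q \<in> polys_over A. poly q a \<in> I}"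
  have JI: "poly q x \<in> J \<longleftrightarrow> poly q a \<in> I" if "q \<in> polys_over A" for q
  proof
    assume "poly q x \<in> J"
    then obtain q' where q': "q' \<in> polys_over A" "poly q' a \<in> I" "poly q' x = poly q x"
      by (auto simp: J_def)
    then have "q - q' = 0" using that by (intro x self.polys_over_diff) auto
    then show "poly q a \<in> I" using q' by simp
  qed (use that in \<open>auto simp: J_def\<close>)
  interpret sub: subring "adjoin A x" by (fact sub)
  have "finite_index_ideal (adjoin A x) J"
  proof
    show "J \<subseteq> adjoin A x" by (auto simp: J_def adjoin_def)
    show "0 \<in> J" using JI[of 0] I.ideal_zero self.polys_over_zero by simp
    show "1 \<notin> J" using JI[of "[:1:]"] I.one_notin self.polys_over_const[OF one_mem] by simp
    show "y - z \<in> J" if "y \<in> J" "z \<in> J" for y z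
    proof -
      from that obtain q r where qr: "q \<in> polys_over A" "r \<in> polys_over A" "poly q a \<in> I" "poly r a \<in> I"
        "y = poly q x" "z = poly r x" by (auto simp: J_def)
      then show ?thesis using JI[OF self.polys_over_diff[OF qr(1,2)]] I.ideal_diff by auto
    qed
    show "y * z \<in> J" if "y \<in> adjoin A x" "z \<in> J" for y z
    proof -
      from that obtain q r where qr: "q \<in> polys_over A" "r \<in> polys_over A" "poly r a \<in> I"
        "y = poly q x" "z = poly r x" by (auto simp: J_def adjoin_def)
      then show ?thesis using JI[OF self.polys_over_mult[OF qr(1,2)]] I.ideal_mult mem by auto
    qed
    obtain R where R: "finite R" "R \<subseteq> A" "\<And>a. a \<in> A \<Longrightarrow> \<exists>r\<in>R. a - r \<in> I"
      using I.finite_quotient by blast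
    have "\<exists>r\<in>R. y - r \<in> J" if "y \<in> adjoin A x" for y
    proof -
      from that obtain q where q: "q \<in> polys_over A" "y = poly q x" by (auto simp: adjoin_def)
      obtain r where r: "r \<in> R" "poly q a - r \<in> I" using R(3)[OF mem[OF q(1)]] by blast
      then have "q - [:r:] \<in> polys_over A" using R(2) q by (intro self.polys_over_diff self.polys_over_const) auto
      from JI[OF this] show ?thesis using r q by auto
    qed
    then show "\<exists>R. finite R \<and> R \<subseteq> adjoin A x \<and> (\<forall>a\<in>adjoin A x. \<exists>r\<in>R. a - r \<in> J)"
      using R subset_adjoin[of x] by (intro exI[of _ R]) auto
  qed
  moreover have "p * [:e:] - [:1:] \<in> polys_over A"
    using p I one_mem by (intro self.polys_over_diff self.polys_over_mult self.polys_over_const)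
  from JI[OF this] have "d * e - 1 \<in> J" using I p by (simp add: mult.commute)
  ultimately show "\<exists>J. finite_index_ideal (adjoin A x) J \<and> (\<exists>e\<in>adjoin A x. d * e - 1 \<in> J)"
    using I(2) subset_adjoin[of x] by blast
qed

text \<open>Minimality of \<open>p\<close> is only available over \<open>A\<close>, so division with remainder in the fraction
  field is replaced by pseudo-division.\<close>

lemma adjoin_algebraic_multiple:
  fixes A :: "'a::idom set"
  assumes "subring A" and p: "p \<in> polys_over A" "p \<noteq> 0" "poly p x = 0"
    and min: "\<And>q. q \<in> polys_over A \<Longrightarrow> poly q x = 0 \<Longrightarrow> degree q < degree p \<Longrightarrow> q = 0"
    and d: "d \<in> adjoin A x" "d \<noteq> 0"
  shows "\<exists>h\<in>adjoin A x. d * h \<in> A \<and> d * h \<noteq> 0"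
proof -
  interpret subring A by fact
  interpret sub: subring "adjoin A x" by (rule subring_adjoin)
  have pos: "degree p > 0"
  proof (rule ccontr)
    assume "\<not> degree p > 0"
    then obtain a where "p = [:a:]" by (auto elim: degree_eq_zeroE)
    then show False using p by auto
  qed
  \<comment> \<open>These polynomials represent the nonzero multiples of \<open>d\<close> in A[x].
    One of least degree will turn out to be constant, and its value is the wanted element of
    \<open>A\<close>.\<close>
  define S where "S = {f \<in> polys_over A. poly f x \<noteq> 0 \<and> (\<exists>h\<in>adjoin A x. poly f x = d * h)}"
  obtain f0 where "f0 \<in> polys_over A" "d = poly f0 x" using d by (auto simp: adjoin_def)
  then have "f0 \<in> S" using d sub.one_mem by (auto simp: S_def intro!: bexI[of _ 1])
  then obtain f where f: "f \<in> S" "\<And>g. g \<in> S \<Longrightarrow> degree f \<le> degree g"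
    using ex_has_least_nat[of "\<lambda>f. f \<in> S" f0 degree] by blast
  obtain h where fA: "f \<in> polys_over A" "poly f x \<noteq> 0" and h: "h \<in> adjoin A x" "poly f x = d * h"
    using f by (auto simp: S_def)
  have ev: "poly g x \<in> adjoin A x" if "g \<in> polys_over A" for g using that by (auto simp: adjoin_def)
  have lc: "lead_coeff q \<in> A" if "q \<in> polys_over A" for q using that by (auto simp: polys_over_def)
  \<comment> \<open>Reducing \<open>f\<close> modulo \<open>p\<close> only scales its value at
    \<open>x\<close> by a power of the leading coefficient of \<open>p\<close>, so the remainder is
    again in \<open>S\<close>.\<close>
  have fp: "degree f < degree p"
  proof -
    obtain k g r where gr: "g \<in> polys_over A" "r \<in> polys_over A"
      "smult (lead_coeff p ^ k) f = p * g + r" "degree r < degree p"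
      using pseudo_division[OF subring_ideal_self p(1) pos fA(1)] by blast
    have "poly (smult (lead_coeff p ^ k) f) x = poly (p * g + r) x" by (simp only: gr)
    then have "poly r x = lead_coeff p ^ k * (d * h)" using p h by simp
    moreover have "lead_coeff p ^ k * h \<in> adjoin A x"
      using lc[OF p(1)] subset_adjoin[of x] h by (intro sub.mult_mem sub.power_mem) auto
    ultimately have "r \<in> S" using gr p(2) fA h
      by (auto simp: S_def intro!: bexI[of _ "lead_coeff p ^ k * h"])
    from f(2)[OF this] show ?thesis using gr by simp
  qed
  \<comment> \<open>Otherwise divide \<open>p\<close> by \<open>f\<close>: the remainder, of too
    small degree to lie in \<open>S\<close>, vanishes at \<open>x\<close>, hence so does
    \<open>g\<close>. Minimality of \<open>p\<close> gives \<open>g = 0\<close>, and a nonzero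
    multiple of \<open>p\<close> equals a remainder of smaller degree.\<close>
  have "degree f = 0"
  proof (rule ccontr)
    assume f0: "degree f \<noteq> 0"
    then obtain k g r where gr: "g \<in> polys_over A" "r \<in> polys_over A"
      "smult (lead_coeff f ^ k) p = f * g + r" "degree r < degree f"
      using pseudo_division[OF subring_ideal_self fA(1) _ p(1)] by blast
    have "poly (smult (lead_coeff f ^ k) p) x = poly (f * g + r) x" by (simp only: gr)
    then have e: "poly r x = d * (- h * poly g x)" using p h
      by (simp add: eq_neg_iff_add_eq_0 algebra_simps)
    have "- h * poly g x \<in> adjoin A x"
      using sub.diff_mem[OF sub.zero_mem h(1)] ev[OF gr(1)] by (intro sub.mult_mem) auto
    then have "r \<notin> S \<Longrightarrow> poly r x = 0" using e gr(2) by (auto simp: S_def)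
    then have r0: "poly r x = 0" using f(2)[of r] gr(4) by fastforce
    then have g0: "poly g x = 0" using e h fA by auto
    have nz: "smult (lead_coeff f ^ k) p \<noteq> 0" using p(2) f0 by auto
    have dg: "degree (smult (lead_coeff f ^ k) p) = degree p" using f0 by auto
    have "g = 0"
    proof (rule ccontr)
      assume "g \<noteq> 0"
      then have "degree (f * g) = degree f + degree g" using f0 by (intro degree_mult_eq) auto
      moreover have "degree (f * g) \<le> degree p"
      proof -
        have "f * g = smult (lead_coeff f ^ k) p - r" using gr(3) by simp
        then show ?thesis using gr(4) fp dg by (metis degree_diff_le less_imp_le less_trans order_refl)
      qed
      ultimately have "degree g < degree p" using f0 by simp
      from min[OF gr(1) g0 this] \<open>g \<noteq> 0\<close> show False by simp
    qed
    then show False using gr(3,4) dg fp by simp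
  qed
  then obtain a where "f = [:a:]" by (auto elim: degree_eq_zeroE)
  then have "poly f x \<in> A" using lc[OF fA(1)] by simp
  then show ?thesis using h fA by auto
qed

text \<open>The ideal used is \<open>I A[x]\<close>, where \<open>I\<close> makes both a multiple of \<open>d\<close> and the leading
  coefficient of a minimal equation for \<open>x\<close> invertible. The latter gives finite index, and
  properness because no nontrivial relation of smaller degree holds.\<close>

lemma units_survive_adjoin_algebraic:
  fixes A :: "'a::idom set"
  assumes A: "units_survive A" and ex: "\<exists>p\<in>polys_over A. p \<noteq> 0 \<and> poly p x = 0"
  shows "units_survive (adjoin A x)"
  unfolding units_survive_def
proof (intro conjI ballI impI)
  interpret subring A using A by (auto simp: units_survive_def)
  show sub: "subring (adjoin A x)" by (rule subring_adjoin)
  interpret sub: subring "adjoin A x" by (fact sub)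
  define Q where "Q p \<longleftrightarrow> p \<in> polys_over A \<and> p \<noteq> 0 \<and> poly p x = 0" for p
  obtain p where "Q p" "\<And>q. Q q \<Longrightarrow> degree p \<le> degree q"
    using ex ex_has_least_nat[of Q _ degree] unfolding Q_def by blast
  then have p: "p \<in> polys_over A" "p \<noteq> 0" "poly p x = 0"
    and min: "\<And>q. q \<in> polys_over A \<Longrightarrow> poly q x = 0 \<Longrightarrow> degree q < degree p \<Longrightarrow> q = 0"
    by (auto simp: Q_def not_le[symmetric])
  have pos: "degree p > 0"
  proof (rule ccontr)
    assume "\<not> degree p > 0"
    then obtain a where "p = [:a:]" by (auto elim: degree_eq_zeroE)
    then show False using p by auto
  qed
  define n where "n = degree p"
  define c where "c = lead_coeff p"
  have c: "c \<in> A" "c \<noteq> 0" using p by (auto simp: c_def polys_over_def)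
  fix d assume d: "d \<in> adjoin A x" "d \<noteq> 0"
  obtain h where h: "h \<in> adjoin A x" "d * h \<in> A" "d * h \<noteq> 0"
    using adjoin_algebraic_multiple[OF subring_axioms p min d] by blast
  \<comment> \<open>The factor \<open>c\<close> is included so that \<open>c\<close> too becomes
    invertible modulo \<open>I\<close>, with inverse \<open>v\<close>.\<close>
  have "d * h * c \<in> A" "d * h * c \<noteq> 0" using h c by (auto intro: mult_mem)
  then obtain I u where I: "finite_index_ideal A I" "u \<in> A" "d * h * c * u - 1 \<in> I"
    using A unfolding units_survive_def by blast
  interpret I: finite_index_ideal A I by (fact I)
  define v where "v = d * h * u"
  have v: "v \<in> A" "c * v - 1 \<in> I" using mult_mem[OF h(2) I(2)] I(3) by (auto simp: v_def mult_ac)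
  define J where "J = (\<lambda>f. poly f x) ` polys_over I"
  have IJ: "a * x ^ i \<in> J" if "a \<in> I" for a i
    unfolding J_def using that by (intro image_eqI[of _ _ "monom a i"] I.polys_over_monom) (auto simp: poly_monom)
  \<comment> \<open>Up to a power of \<open>c\<close>, values at \<open>x\<close> come from
    polynomials of degree below \<open>n\<close>. The case \<open>K = I\<close> serves properness,
    the case \<open>K = A\<close> finite index.\<close>
  have divide: "\<exists>k r. r \<in> polys_over K \<and> c ^ k * poly f x = poly r x \<and> degree r < n"
    if K: "subring_ideal A K" "f \<in> polys_over K" for f K
  proof -
    obtain k g r where gr: "g \<in> polys_over K" "r \<in> polys_over K"
      "smult (c ^ k) f = p * g + r" "degree r < n"
      using pseudo_division[OF K(1) p(1) pos K(2)] unfolding c_def n_def by blast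
    have "poly (smult (c ^ k) f) x = poly (p * g + r) x" by (simp only: gr)
    then have "c ^ k * poly f x = poly r x" using p by simp
    then show ?thesis using gr by blast
  qed
  have "subring_ideal (adjoin A x) J"
  proof
    show "J \<subseteq> adjoin A x" using I.polys_over_subset by (auto simp: J_def adjoin_def)
    show "0 \<in> J" using IJ[OF I.ideal_zero] by simp
    show "y - z \<in> J" if yz: "y \<in> J" "z \<in> J" for y z
    proof -
      obtain q r where "q \<in> polys_over I" "r \<in> polys_over I" "y = poly q x" "z = poly r x"
        using yz by (auto simp: J_def)
      then show ?thesis unfolding J_def by (intro image_eqI[OF _ I.polys_over_diff, of _ _ q r]) auto
    qed
    show "y * z \<in> J" if yz: "y \<in> adjoin A x" "z \<in> J" for y z
    proof -
      obtain q r where "q \<in> polys_over A" "r \<in> polys_over I" "y = poly q x" "z = poly r x"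
        using yz by (auto simp: J_def adjoin_def)
      then show ?thesis unfolding J_def by (intro image_eqI[OF _ I.polys_over_mult, of _ _ q r]) auto
    qed
  qed
  then interpret J: subring_ideal "adjoin A x" J .
  have "finite_index_ideal (adjoin A x) J"
  proof
    \<comment> \<open>If 1 were in \<open>J\<close>, some \<open>c ^ k\<close> would be the value of
      a polynomial \<open>r\<close> over \<open>I\<close> of degree below \<open>n\<close>.
      Minimality of \<open>p\<close> makes \<open>r\<close> the constant \<open>c ^ k\<close>, which
      then lies in \<open>I\<close> although \<open>c\<close> is invertible modulo
      \<open>I\<close>.\<close>
    show "1 \<notin> J"
    proof
      assume "1 \<in> J"
      then obtain f where f: "f \<in> polys_over I" "poly f x = 1" by (auto simp: J_def)
      obtain k r where r: "r \<in> polys_over I" "c ^ k = poly r x" "degree r < n"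
        using divide[OF I.subring_ideal_axioms f(1)] f(2) by auto
      have "[:c ^ k:] - r = 0"
      proof (rule min)
        show "[:c ^ k:] - r \<in> polys_over A"
          using r(1) I.polys_over_subset c by (intro self.polys_over_diff self.polys_over_const power_mem) auto
        show "poly ([:c ^ k:] - r) x = 0" using r by simp
        show "degree ([:c ^ k:] - r) < degree p"
          using r(3) pos unfolding n_def by (intro degree_diff_less) auto
      qed
      then have "r = [:c ^ k:]" by simp
      then have "coeff r 0 = c ^ k" by simp
      then have "c ^ k \<in> I" using r(1) by (metis (mono_tags) mem_Collect_eq polys_over_def)
      from I.one_mem_if_unit_power_mem[OF v(2) c(1) v(1) this] I.one_notin show False by simp
    qed
    obtain R where R: "finite R" "R \<subseteq> A" "\<And>a. a \<in> A \<Longrightarrow> \<exists>r\<in>R. a - r \<in> I"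
      using I.finite_quotient by blast
    \<comment> \<open>The representatives are the combinations of the powers of \<open>x\<close>
      below \<open>n\<close> with coefficients representing \<open>A\<close> modulo
      \<open>I\<close>.\<close>
    define R' where "R' = (\<lambda>w. \<Sum>i<n. w i * x ^ i) ` ({..<n} \<rightarrow>\<^sub>E R)"
    have "finite R'" unfolding R'_def using R by (intro finite_imageI finite_PiE) auto
    moreover have "R' \<subseteq> adjoin A x"
      unfolding R'_def using R(2) subset_adjoin[of x] mem_adjoin[of x]
      by (auto intro!: sub.sum_mem sub.mult_mem sub.power_mem)
    moreover have "\<exists>s\<in>R'. y - s \<in> J" if "y \<in> adjoin A x" for y
    proof -
      from that obtain f where f: "f \<in> polys_over A" "y = poly f x" by (auto simp: adjoin_def)
      obtain k r where r: "r \<in> polys_over A" "c ^ k * y = poly r x" "degree r < n"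
        using divide[OF self.subring_ideal_axioms f(1)] f(2) by auto
      \<comment> \<open>Multiplication by \<open>v ^ k\<close> undoes \<open>c ^ k\<close> modulo
        \<open>J\<close>, so the \<open>b i\<close> are coordinates of \<open>y\<close> modulo
        \<open>J\<close>.\<close>
      define b where "b i = v ^ k * coeff r i" for i
      have "b i \<in> A" for i using r(1) v by (auto simp: b_def polys_over_def intro!: mult_mem power_mem)
      then have "\<forall>i. \<exists>r. r \<in> R \<and> b i - r \<in> I" using R(3) by blast
      then obtain w where w: "\<And>i. w i \<in> R" "\<And>i. b i - w i \<in> I" by metis
      define s where "s = (\<Sum>i<n. restrict w {..<n} i * x ^ i)"
      have "s \<in> R'" unfolding s_def R'_def using w by (intro imageI restrict_PiE_iff[THEN iffD2]) auto
      have "poly r x = (\<Sum>i<n. coeff r i * x ^ i)"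
        unfolding poly_altdef using r(3)
        by (intro sum.mono_neutral_left) (auto simp: coeff_eq_0 not_le[symmetric])
      then have "v ^ k * (c ^ k * y) = (\<Sum>i<n. b i * x ^ i)"
        unfolding r(2) b_def by (simp add: sum_distrib_left mult.assoc)
      then have "v ^ k * (c ^ k * y) - s = (\<Sum>i<n. (b i - w i) * x ^ i)"
        by (simp add: s_def sum_subtractf left_diff_distrib)
      also have "\<dots> \<in> J" using w IJ by (intro J.ideal_sum) auto
      finally have 1: "v ^ k * (c ^ k * y) - s \<in> J" .
      have "(c * v) ^ k - 1 ^ k \<in> I" using v c by (intro I.cong_power) (auto intro: mult_mem one_mem)
      then have "(c * v) ^ k - 1 \<in> J" using IJ[of _ 0] by auto
      then have "((c * v) ^ k - 1) * y \<in> J" using that by (rule J.ideal_mult')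
      from J.ideal_diff[OF 1 this] have "y - s \<in> J" by (simp add: algebra_simps power_mult_distrib)
      then show ?thesis using \<open>s \<in> R'\<close> by blast
    qed
    ultimately show "\<exists>R. finite R \<and> R \<subseteq> adjoin A x \<and> (\<forall>a\<in>adjoin A x. \<exists>r\<in>R. a - r \<in> J)"
      by blast
  qed
  moreover have "d * (h * c * u) - 1 \<in> J" using IJ[OF I(3), of 0] by (simp add: mult_ac)
  moreover have "h * c * u \<in> adjoin A x"
    using h c I subset_adjoin[of x] by (intro sub.mult_mem) auto
  ultimately show "\<exists>J. finite_index_ideal (adjoin A x) J \<and> (\<exists>e\<in>adjoin A x. d * e - 1 \<in> J)"
    by blast
qed

text \<open>The elements of \<open>F\<close> are adjoined to the integers one at a time, each
  algebraic or transcendental over the ring reached so far.\<close>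

theorem finite_subset_units_survive:
  fixes F :: "'a::{idom, ring_char_0} set"
  assumes "finite F"
  shows "\<exists>A. F \<subseteq> A \<and> units_survive A"
  using assms
proof induction
  case empty
  then show ?case using units_survive_Ints by auto
next
  case (insert x F)
  then obtain A where A: "F \<subseteq> A" "units_survive A" by blast
  then interpret subring A by (auto simp: units_survive_def)
  have "units_survive (adjoin A x)"
    using units_survive_adjoin_algebraic[OF A(2), of x] units_survive_adjoin_transcendental[OF A(2), of x] by auto
  then show ?case using A subset_adjoin[of x] mem_adjoin[of x] by blast
qed

section \<open>Isometries as linear maps of the hyperboloid\<close>

text \<open>This is inverse stereographic projection from the Poincare disc to the upper sheet of
  the hyperboloid in Minkowski space.\<close>

definition hyperboloid :: "complex \<Rightarrow> complex \<times> real" where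
  "hyperboloid z = ((2 / (1 - (cmod z)\<^sup>2)) *\<^sub>R z, (1 + (cmod z)\<^sup>2) / (1 - (cmod z)\<^sup>2))"

definition lorentz :: "complex \<times> real \<Rightarrow> complex \<times> real \<Rightarrow> real" where
  "lorentz p q = fst p \<bullet> fst q - snd p * snd q"

section \<open>Hyperbolic distance as a Lorentz product\<close>

lemma hdisc_iff: "z \<in> hdisc \<longleftrightarrow> (cmod z)\<^sup>2 < 1"
  by (simp add: hdisc_def power_less_one_iff)

lemma bounded_bilinear_lorentz: "bounded_bilinear lorentz"
proof -
  have "bilinear lorentz"
    by (auto simp: bilinear_def linear_iff lorentz_def algebra_simps inner_simps)
  then show ?thesis by (rule bilinear_conv_bounded_bilinear[THEN iffD1])
qed

interpretation lorentz: bounded_bilinear lorentz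
  by (rule bounded_bilinear_lorentz)

text \<open>The right side is minus the argument of \<open>arcosh\<close> in
  \<open>hdist\<close>.\<close>

lemma lorentz_hyperboloid:
  assumes "z \<in> hdisc" "w \<in> hdisc"
  shows "lorentz (hyperboloid z) (hyperboloid w) =
    - (1 + 2 * (cmod (z - w))\<^sup>2 / ((1 - (cmod z)\<^sup>2) * (1 - (cmod w)\<^sup>2)))"
proof -
  define a b where ab: "a = (cmod z)\<^sup>2" "b = (cmod w)\<^sup>2"
  have pos: "1 - a \<noteq> 0" "1 - b \<noteq> 0" using assms by (auto simp: hdisc_iff ab)
  have d: "(cmod (z - w))\<^sup>2 = a + b - 2 * (z \<bullet> w)"
    unfolding ab power2_norm_eq_inner by (simp add: inner_simps inner_commute)
  have "lorentz (hyperboloid z) (hyperboloid w) =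
    (2 / (1 - a)) * ((2 / (1 - b)) * (z \<bullet> w)) - (1 + a) / (1 - a) * ((1 + b) / (1 - b))"
    by (simp add: lorentz_def hyperboloid_def ab)
  also have "\<dots> = - (1 + 2 * (a + b - 2 * (z \<bullet> w)) / ((1 - a) * (1 - b)))"
    using pos by (simp add: divide_simps) (simp add: algebra_simps)
  finally show ?thesis by (simp add: d ab)
qed

lemma cosh_hdist:
  assumes "z \<in> hdisc" "w \<in> hdisc"
  shows "cosh (hdist z w) = - lorentz (hyperboloid z) (hyperboloid w)"
  using assms unfolding lorentz_hyperboloid[OF assms] hdist_def
  by (subst cosh_arcosh_real) (auto simp: hdisc_iff)

text \<open>A Lorentz product equal to -1 forces two points of the disc to coincide.\<close>

lemma hyperboloid_inj:
  assumes "z \<in> hdisc" "w \<in> hdisc" "hyperboloid z = hyperboloid w"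
  shows "z = w"
proof -
  have "lorentz (hyperboloid z) (hyperboloid w) = lorentz (hyperboloid z) (hyperboloid z)"
    using assms by simp
  then show ?thesis
    using assms(1,2) by (auto simp: lorentz_hyperboloid hdisc_iff)
qed

lemma lorentz_nondegenerate:
  assumes "\<And>w. w \<in> hdisc \<Longrightarrow> lorentz p (hyperboloid w) = 0"
  shows "p = 0"
proof -
  obtain u s where p: "p = (u, s)" by (cases p)
  \<comment> \<open>The images of these three points span the three-dimensional ambient
    space.\<close>
  have h: "hyperboloid 0 = (0, 1)" "hyperboloid (1/2) = (4/3, 5/3)" "hyperboloid (\<i>/2) = (4/3 * \<i>, 5/3)"
    by (auto simp: hyperboloid_def power2_eq_square norm_divide complex_eq_iff)
  have "s = 0" using assms[of 0] by (simp add: h lorentz_def p hdisc_def)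
  moreover have "Re u = 0" using assms[of "1/2"] \<open>s = 0\<close>
    by (simp add: h lorentz_def p hdisc_def inner_complex_def norm_divide)
  moreover have "Im u = 0" using assms[of "\<i>/2"] \<open>s = 0\<close>
    by (simp add: h lorentz_def p hdisc_def inner_complex_def norm_divide)
  ultimately show ?thesis by (simp add: p complex_eq_iff zero_prod_def)
qed

section \<open>Isometries acting on the hyperboloid\<close>

lemma isom_H2_mem: "f \<in> isom_H2 \<Longrightarrow> z \<in> hdisc \<Longrightarrow> f z \<in> hdisc"
  by (auto simp: isom_H2_def bij_betw_def)

lemma isom_H2_lorentz:
  assumes "f \<in> isom_H2" "z \<in> hdisc" "w \<in> hdisc"
  shows "lorentz (hyperboloid (f z)) (hyperboloid (f w)) = lorentz (hyperboloid z) (hyperboloid w)"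
proof -
  have "cosh (hdist (f z) (f w)) = cosh (hdist z w)"
    using assms by (simp add: isom_H2_def)
  then show ?thesis using assms by (simp add: cosh_hdist isom_H2_mem)
qed

text \<open>Being the identity off the disc makes \<open>f\<close> a bijection of the whole plane,
  so \<open>inv f\<close> is a genuine inverse.\<close>

lemma isom_H2_bij:
  assumes "f \<in> isom_H2"
  shows "bij f"
proof -
  have "bij_betw f hdisc hdisc" using assms by (simp add: isom_H2_def)
  moreover have "bij_betw f (- hdisc) (- hdisc)"
    using assms bij_betw_cong[of "- hdisc" f id "- hdisc"] bij_id by (auto simp: isom_H2_def)
  ultimately have "bij_betw f (hdisc \<union> - hdisc) (hdisc \<union> - hdisc)"
    by (intro bij_betw_combine) auto
  then show ?thesis by simp
qed

text \<open>Two candidates for the image of a vector have the same Lorentz products with the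
  spanning set of all \<open>hyperboloid (f w)\<close>, hence agree.\<close>

lemma isom_H2_linear:
  assumes f: "f \<in> isom_H2"
  shows "\<exists>L. linear L \<and> (\<forall>z\<in>hdisc. L (hyperboloid z) = hyperboloid (f z))"
proof -
  obtain B where B: "B \<subseteq> hyperboloid ` hdisc" "independent B" "hyperboloid ` hdisc \<subseteq> span B"
    by (rule maximal_independent_subset)
  define q where "q = inv_into hdisc hyperboloid"
  have q: "q b \<in> hdisc" "hyperboloid (q b) = b" if "b \<in> B" for b
    using B(1) that by (auto simp: q_def intro: inv_into_into f_inv_into_f)
  obtain L where L: "linear L" "\<forall>b\<in>B. L b = hyperboloid (f (q b))"
    using linear_independent_extend[OF B(2), of "\<lambda>b. hyperboloid (f (q b))"] by auto
  have key: "lorentz (L p) (hyperboloid (f w)) = lorentz p (hyperboloid w)"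
    if "p \<in> span B" "w \<in> hdisc" for p w
    using that(1)
  proof (induction rule: span_induct_alt)
    case base
    then show ?case using linear_0[OF L(1)] by (simp add: lorentz.zero_left)
  next
    case (step c b p)
    then show ?case
      using L q[of b] isom_H2_lorentz[OF f, of "q b" w] that(2)
      by (simp add: linear_add linear_scale lorentz.add_left lorentz.scaleR_left)
  qed
  have "L (hyperboloid z) = hyperboloid (f z)" if z: "z \<in> hdisc" for z
  proof -
    have "L (hyperboloid z) - hyperboloid (f z) = 0"
    proof (rule lorentz_nondegenerate)
      fix w' assume "w' \<in> hdisc"
      then have "w' \<in> f ` hdisc" using f by (simp add: isom_H2_def bij_betw_def)
      then obtain w where w: "w \<in> hdisc" "w' = f w" by blast
      then show "lorentz (L (hyperboloid z) - hyperboloid (f z)) (hyperboloid w') = 0"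
        using key[of "hyperboloid z" w] B(3) z isom_H2_lorentz[OF f z w(1)]
        by (auto simp: lorentz.diff_left)
    qed
    then show ?thesis by simp
  qed
  then show ?thesis using L by blast
qed

text \<open>A fixed Lorentz product with \<open>u\<close> means a fixed distance from
  \<open>u\<close>, and hyperbolic spheres are compact in the disc.\<close>

lemma finite_hyperbolic_sphere:
  assumes V: "locally_finite_points V" "V \<subseteq> hdisc" and u: "u \<in> hdisc"
  shows "finite {w \<in> V. lorentz (hyperboloid w) (hyperboloid u) = k}"
proof -
  define b where "b = (cmod u)\<^sup>2"
  have b: "b < 1" using u by (simp add: b_def hdisc_iff)
  \<comment> \<open>With denominators cleared the equation makes sense on the closed disc. On the
    unit circle its right side vanishes, leaving only \<open>w = u\<close>, so \<open>K\<close>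
    avoids the circle.\<close>
  define K where "K = {w \<in> cball 0 1. 2 * (cmod (w - u))\<^sup>2 = (- k - 1) * ((1 - (cmod w)\<^sup>2) * (1 - b))}"
  have "closed {w. 2 * (cmod (w - u))\<^sup>2 = (- k - 1) * ((1 - (cmod w)\<^sup>2) * (1 - b))}"
    by (intro closed_Collect_eq continuous_intros)
  then have "compact (cball 0 1 \<inter> {w. 2 * (cmod (w - u))\<^sup>2 = (- k - 1) * ((1 - (cmod w)\<^sup>2) * (1 - b))})"
    by (intro compact_Int_closed) auto
  also have "cball 0 1 \<inter> {w. 2 * (cmod (w - u))\<^sup>2 = (- k - 1) * ((1 - (cmod w)\<^sup>2) * (1 - b))} = K"
    by (auto simp: K_def)
  finally have "compact K" .
  moreover have "K \<subseteq> hdisc"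
  proof
    fix w assume w: "w \<in> K"
    show "w \<in> hdisc"
    proof (rule ccontr)
      assume "w \<notin> hdisc"
      then have "cmod w = 1" using w by (auto simp: K_def hdisc_def)
      then have "w = u" using w by (auto simp: K_def)
      then show False using \<open>w \<notin> hdisc\<close> u by simp
    qed
  qed
  ultimately have "finite (K \<inter> V)" using V(1) by (auto simp: locally_finite_points_def)
  moreover have "{w \<in> V. lorentz (hyperboloid w) (hyperboloid u) = k} \<subseteq> K \<inter> V"
  proof safe
    fix w assume w: "w \<in> V" "k = lorentz (hyperboloid w) (hyperboloid u)"
    then have wd: "w \<in> hdisc" using V by auto
    then have "(cmod w)\<^sup>2 < 1" by (simp add: hdisc_iff)
    then show "w \<in> K" using w wd b unfolding K_def lorentz_hyperboloid[OF wd u]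
      by (auto simp: b_def hdisc_def)
  qed
  ultimately show ?thesis by (rule finite_subset[rotated])
qed

section \<open>Congruence subgroups and orbit colourings\<close>

lemma isom_subgroup_simps:
  assumes "isom_subgroup G" "g \<in> G"
  shows "bij g" "inv g \<in> G" "g \<circ> inv g = id" "inv g \<circ> g = id" "g (inv g x) = x" "inv g (g x) = x"
proof -
  show b: "bij g" using assms isom_H2_bij by (auto simp: isom_subgroup_def)
  show "inv g \<in> G" using assms by (auto simp: isom_subgroup_def)
  show "g \<circ> inv g = id" "inv g \<circ> g = id" "g (inv g x) = x" "inv g (g x) = x"
    using bij_is_inj[OF b] bij_is_surj[OF b] surj_f_inv_f[of g x] by (auto simp: surj_iff)
qed

lemma isom_subgroup_comp: "isom_subgroup G \<Longrightarrow> f \<in> G \<Longrightarrow> g \<in> G \<Longrightarrow> f \<circ> g \<in> G"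
  by (auto simp: isom_subgroup_def)

lemma isom_subgroup_id: "isom_subgroup G \<Longrightarrow> id \<in> G"
  by (auto simp: isom_subgroup_def)

text \<open>Such a relation stands for a homomorphism to a finite group. It will be entrywise
  congruence of matrices, and no matrix group over a quotient ring has to be built.\<close>

locale group_congruence =
  fixes G :: "(complex \<Rightarrow> complex) set" and R :: "(complex \<Rightarrow> complex) \<Rightarrow> (complex \<Rightarrow> complex) \<Rightarrow> bool"
    and Q :: "(complex \<Rightarrow> complex) set"
  assumes G: "isom_subgroup G"
    and refl: "R g g"
    and sym: "R g h \<Longrightarrow> R h g"
    and trans: "R g h \<Longrightarrow> R h k \<Longrightarrow> R g k"
    and comp: "\<lbrakk>g \<in> G; g' \<in> G; h \<in> G; h' \<in> G; R g g'; R h h'\<rbrakk> \<Longrightarrow> R (g \<circ> h) (g' \<circ> h')"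
    and Q: "finite Q" "Q \<subseteq> G" "g \<in> G \<Longrightarrow> \<exists>q\<in>Q. R g q"
begin

definition kernel :: "(complex \<Rightarrow> complex) set" where
  "kernel = {t \<in> G. R t id}"

lemma kernel_subset: "kernel \<subseteq> G"
  by (auto simp: kernel_def)

lemma isom_subgroup_kernel: "isom_subgroup kernel"
  unfolding isom_subgroup_def
proof (intro conjI ballI)
  show "kernel \<subseteq> isom_H2" using G by (auto simp: kernel_def isom_subgroup_def)
  show "id \<in> kernel" using G refl by (auto simp: kernel_def isom_subgroup_def)
  show "f \<circ> g \<in> kernel" if "f \<in> kernel" "g \<in> kernel" for f g
    using that comp[of f id g id] isom_subgroup_comp[OF G] isom_subgroup_id[OF G] by (auto simp: kernel_def)
  show "inv f \<in> kernel" if f: "f \<in> kernel" for f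
  proof -
    have fG: "f \<in> G" "R f id" using f by (auto simp: kernel_def)
    note i = isom_subgroup_simps[OF G fG(1)]
    have "R (inv f \<circ> f) (inv f \<circ> id)"
      using fG i isom_subgroup_id[OF G] refl by (intro comp) auto
    then show ?thesis using i by (auto simp: kernel_def intro: sym)
  qed
qed

lemma div_mem_kernel:
  assumes "g \<in> G" "h \<in> G" "R g h"
  shows "inv h \<circ> g \<in> kernel" "g \<circ> inv h \<in> kernel"
proof -
  note i = isom_subgroup_simps[OF G assms(2)]
  have "R (inv h \<circ> g) (inv h \<circ> h)" "R (g \<circ> inv h) (h \<circ> inv h)"
    by (rule comp; (fact assms i refl)?)+
  then show "inv h \<circ> g \<in> kernel" "g \<circ> inv h \<in> kernel"
    using i assms isom_subgroup_comp[OF G] by (auto simp: kernel_def)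
qed

text \<open>Normality of the kernel, used to carry a question about any vertex back to its orbit
  representative.\<close>

lemma conj_mem_kernel:
  assumes "g \<in> G" "t \<in> kernel"
  shows "inv g \<circ> t \<circ> g \<in> kernel"
proof -
  have t: "t \<in> G" "R t id" using assms by (auto simp: kernel_def)
  have "R (t \<circ> g) (id \<circ> g)" using t assms refl isom_subgroup_id[OF G] by (intro comp) auto
  then have "inv g \<circ> (t \<circ> g) \<in> kernel"
    using t assms isom_subgroup_comp[OF G] by (intro div_mem_kernel) auto
  then show ?thesis by (simp add: comp_assoc)
qed

text \<open>Related elements have the same left coset, so the elements of \<open>Q\<close> give all
  cosets.\<close>

lemma finite_index_kernel: "finite_index_subgroup kernel G"
  unfolding finite_index_subgroup_def
proof (intro conjI)
  show "isom_subgroup kernel" "kernel \<subseteq> G" by (rule isom_subgroup_kernel kernel_subset)+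
  let ?coset = "\<lambda>g. (\<lambda>t. g \<circ> t) ` kernel"
  have le: "?coset g \<subseteq> ?coset h" if "g \<in> G" "h \<in> G" "R g h" for g h
  proof
    fix x assume "x \<in> ?coset g"
    then obtain t where t: "t \<in> kernel" "x = g \<circ> t" by auto
    have "(inv h \<circ> g) \<circ> t \<in> kernel"
      using isom_subgroup_comp[OF isom_subgroup_kernel div_mem_kernel(1)[OF that] t(1)] .
    moreover have "x = h \<circ> (inv h \<circ> g \<circ> t)"
      using t isom_subgroup_simps[OF G that(2)] by (simp add: comp_assoc[symmetric])
    ultimately show "x \<in> ?coset h" by blast
  qed
  have "{?coset g | g. g \<in> G} \<subseteq> ?coset ` Q"
  proof safe
    fix g assume "g \<in> G"
    then obtain q where "q \<in> Q" "R g q" using Q(3) by blast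
    then have "?coset g = ?coset q" using \<open>g \<in> G\<close> Q(2) by (intro equalityI le) (auto intro: sym)
    then show "?coset g \<in> ?coset ` Q" using \<open>q \<in> Q\<close> by blast
  qed
  then show "finite {?coset g | g. g \<in> G}" using Q(1) finite_surj by blast
qed

end

section \<open>Orbit representatives and the separating congruence\<close>

lemma finite_orbit_representatives:
  assumes "quasi_transitive G V" "isom_subgroup G"
  shows "\<exists>P. finite P \<and> P \<subseteq> V \<and> (\<forall>v\<in>V. \<exists>p\<in>P. \<exists>g\<in>G. g p = v)"
proof -
  have "finite ((\<lambda>x. (\<lambda>g. g x) ` G) ` V)"
    using assms(1) by (simp add: quasi_transitive_def setcompr_eq_image)
  from finite_subset_image[OF this order_refl] obtain P where
    P: "P \<subseteq> V" "finite P" "(\<lambda>x. (\<lambda>g. g x) ` G) ` V = (\<lambda>x. (\<lambda>g. g x) ` G) ` P"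
    by blast
  have "\<exists>p\<in>P. \<exists>g\<in>G. g p = v" if "v \<in> V" for v
  proof -
    have "(\<lambda>g. g v) ` G \<in> (\<lambda>x. (\<lambda>g. g x) ` G) ` P"
      using that P(3) by blast
    then obtain p where "p \<in> P" "(\<lambda>g. g v) ` G = (\<lambda>g. g p) ` G" by blast
    moreover have "v \<in> (\<lambda>g. g v) ` G" using isom_subgroup_id[OF assms(2)] by (intro image_eqI[of _ _ id]) auto
    ultimately show ?thesis by auto
  qed
  then show ?thesis using P by blast
qed

text \<open>The matrices of \<open>G\<close> on the span of \<open>hyperboloid ` V\<close> have entries in the ring generated by
  the finitely many entries of the elements moving some representative to itself, to another
  representative or to a neighbour, since these generate \<open>G\<close> as a monoid.\<close>

lemma separating_congruence:
  assumes V: "locally_finite_points V" "V \<subseteq> hdisc" "V \<noteq> {}"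
    and G: "isom_subgroup G" "\<And>g v. g \<in> G \<Longrightarrow> v \<in> V \<Longrightarrow> g v \<in> V"
    and P: "finite P" "P \<subseteq> V" "\<And>v. v \<in> V \<Longrightarrow> \<exists>p\<in>P. \<exists>g\<in>G. g p = v"
    and N: "finite N" "P \<subseteq> N" "N \<subseteq> V"
    and conn: "\<And>u v. u \<in> V \<Longrightarrow> v \<in> V \<Longrightarrow> (adj E)\<^sup>*\<^sup>* u v"
    and adj: "\<And>p g v. p \<in> P \<Longrightarrow> g \<in> G \<Longrightarrow> adj E (g p) v \<Longrightarrow> inv g v \<in> N"
  shows "\<exists>R Q. group_congruence G R Q \<and>
           (\<forall>t\<in>G. R t id \<longrightarrow> (\<exists>p\<in>P. t p \<in> N) \<longrightarrow> (\<forall>x\<in>V. t x = x))"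
proof -
  let ?X = hyperboloid
  have GH: "G \<subseteq> isom_H2" using G by (simp add: isom_subgroup_def)
  obtain B where B: "B \<subseteq> ?X ` V" "independent B" "?X ` V \<subseteq> span B"
    by (rule maximal_independent_subset)
  have finB: "finite B" using B(2) by (rule finiteI_independent)
  define q where "q = inv_into V ?X"
  have q: "q b \<in> V" "?X (q b) = b" if "b \<in> B" for b
  proof -
    have "b \<in> ?X ` V" using B(1) that by blast
    then show "q b \<in> V" "?X (q b) = b" by (simp_all add: q_def inv_into_into f_inv_into_f)
  qed
  have sp: "?X v \<in> span B" if "v \<in> V" for v using B(3) that by auto
  have image_span: "?X (g (q d)) \<in> span B" if "g \<in> G" "d \<in> B" for g d
    using sp[OF G(2)[OF that(1) q(1)[OF that(2)]]] .
  \<comment> \<open>\<open>M g\<close> is the matrix of \<open>g\<close> in the basis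
    \<open>B\<close>. Basis vectors come from vertices, so local finiteness can control the
    entries.\<close>
  define M where "M g b c = representation B (?X (g (q c))) b" for g b c
  have expand: "(\<Sum>b\<in>B. M g b c *\<^sub>R b) = ?X (g (q c))" if "g \<in> G" "c \<in> B" for g c
    unfolding M_def using B(2) finB image_span[OF that] by (intro real_vector.sum_representation_eq) auto
  have M_id: "M id b c = (if b = c then 1 else 0)" if "c \<in> B" for b c
    using real_vector.representation_basis[OF B(2) that] q[OF that] by (auto simp: M_def)
  have M_comp: "M (g \<circ> h) b c = (\<Sum>d\<in>B. M g b d * M h d c)"
    if gh: "g \<in> G" "h \<in> G" and bc: "b \<in> B" "c \<in> B" for g h b c
  proof -
    have "g \<in> isom_H2" using gh GH by blast
    then obtain L where L: "linear L" "\<And>z. z \<in> hdisc \<Longrightarrow> L (?X z) = ?X (g z)"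
      using isom_H2_linear by blast
    have Ld: "L d = ?X (g (q d))" if "d \<in> B" for d
      using L(2)[of "q d"] q[OF that] V(2) by auto
    have hV: "h (q c) \<in> V" using G gh bc q by blast
    have "?X ((g \<circ> h) (q c)) = L (?X (h (q c)))" using L(2) V(2) hV by auto
    also have "\<dots> = L (\<Sum>d\<in>B. M h d c *\<^sub>R d)" using expand[OF gh(2) bc(2)] by simp
    also have "\<dots> = (\<Sum>d\<in>B. M h d c *\<^sub>R ?X (g (q d)))"
      by (simp add: linear_sum[OF L(1)] linear_scale[OF L(1)] Ld)
    finally have "M (g \<circ> h) b c = representation B (\<Sum>d\<in>B. M h d c *\<^sub>R ?X (g (q d))) b"
      by (simp add: M_def)
    also have "\<dots> = (\<Sum>d\<in>B. representation B (M h d c *\<^sub>R ?X (g (q d))) b)"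
    proof -
      have "M h d c *\<^sub>R ?X (g (q d)) \<in> span B" if "d \<in> B" for d
        using image_span[OF gh(1) that] by (rule span_scale)
      then show ?thesis by (simp only: real_vector.representation_sum[OF B(2)])
    qed
    also have "\<dots> = (\<Sum>d\<in>B. M g b d * M h d c)"
    proof (intro sum.cong refl)
      fix d assume "d \<in> B"
      from image_span[OF gh(1) this] show "representation B (M h d c *\<^sub>R ?X (g (q d))) b = M g b d * M h d c"
        by (subst real_vector.representation_scale[OF B(2)]) (auto simp: M_def)
    qed
    finally show ?thesis .
  qed
  define S where "S = {g \<in> G. \<exists>p\<in>P. g p \<in> N}"
  have idS: "id \<in> S" using V(3) P N(2) isom_subgroup_id[OF G(1)] by (auto simp: S_def)
  \<comment> \<open>\<open>g (q c)\<close> is as far from \<open>g p\<close> as \<open>q c\<close>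
    is from \<open>p\<close>, and \<open>g p\<close> is one of the finitely many points of
    \<open>N\<close>; hence it lies on one of finitely many spheres.\<close>
  have finS: "finite {g (q c) | g. g \<in> S}" if c: "c \<in> B" for c
  proof (rule finite_subset)
    let ?W = "\<lambda>p u. {w \<in> V. lorentz (?X w) (?X u) = lorentz (?X (q c)) (?X p)}"
    show "finite (\<Union>p\<in>P. \<Union>u\<in>N. ?W p u)"
      using P(1) N(1,3) V by (intro finite_UN_I finite_hyperbolic_sphere) auto
    show "{g (q c) | g. g \<in> S} \<subseteq> (\<Union>p\<in>P. \<Union>u\<in>N. ?W p u)"
    proof safe
      fix g assume "g \<in> S"
      then obtain p where p: "g \<in> G" "p \<in> P" "g p \<in> N" by (auto simp: S_def)
      then have "lorentz (?X (g (q c))) (?X (g p)) = lorentz (?X (q c)) (?X p)"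
        using GH q(1)[OF c] P(2) V(2) by (intro isom_H2_lorentz) auto
      then show "g (q c) \<in> (\<Union>p\<in>P. \<Union>u\<in>N. ?W p u)"
        using p G(2)[OF p(1) q(1)[OF c]] by auto
    qed
  qed
  define F where "F = (\<Union>c\<in>B. \<Union>b\<in>B. (\<lambda>w. representation B (?X w) b) ` {g (q c) | g. g \<in> S})"
  have finF: "finite F" unfolding F_def using finB finS by auto
  have memF: "M g b c \<in> F" if "g \<in> S" "b \<in> B" "c \<in> B" for g b c
    unfolding F_def M_def using that by blast
  obtain A where A: "F \<subseteq> A" "units_survive A" using finite_subset_units_survive[OF finF] by blast
  then interpret subring A by (auto simp: units_survive_def)
  have entries_comp: "M (g \<circ> h) b c \<in> A"
    if "g \<in> G" "h \<in> G" "\<And>b c. b \<in> B \<Longrightarrow> c \<in> B \<Longrightarrow> M g b c \<in> A"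
      "\<And>b c. b \<in> B \<Longrightarrow> c \<in> B \<Longrightarrow> M h b c \<in> A" "b \<in> B" "c \<in> B" for g h b c
    unfolding M_comp[OF that(1,2,5,6)] using that by (intro sum_mem mult_mem)
  have memA: "M g b c \<in> A" if "g \<in> S" "b \<in> B" "c \<in> B" for g b c
    using memF[OF that] A(1) by blast
  obtain v0 where "v0 \<in> V" using V(3) by auto
  from P(3)[OF this] obtain p0 where p0: "p0 \<in> P" by blast
  \<comment> \<open>\<open>reach v\<close> provides an element with entries in \<open>A\<close> that
    carries a representative to \<open>v\<close>. Along a path of the graph each edge contributes
    one more factor from \<open>S\<close>.\<close>
  define reach where "reach v \<longleftrightarrow> (\<exists>h\<in>G. \<exists>p\<in>P. h p = v \<and> (\<forall>b\<in>B. \<forall>c\<in>B. M h b c \<in> A))" for v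
  have reach_step: "reach v" if v: "v \<in> V" and h: "h \<in> G" "\<forall>b\<in>B. \<forall>c\<in>B. M h b c \<in> A" "inv h v \<in> N" for v h
  proof -
    obtain k p where k: "k \<in> G" "p \<in> P" "k p = inv h v" using P(3) h N(3) by blast
    then have "k p \<in> N" using h by simp
    then have "k \<in> S" using k(1,2) unfolding S_def by blast
    then have "\<forall>b\<in>B. \<forall>c\<in>B. M (h \<circ> k) b c \<in> A"
      using h(2) by (intro ballI entries_comp[OF h(1) k(1)]) (blast intro: memA)+
    then show ?thesis
      unfolding reach_def using k h isom_subgroup_comp[OF G(1)] isom_subgroup_simps(5)[OF G(1) h(1)]
      by (intro bexI[of _ "h \<circ> k"] bexI[of _ p]) auto
  qed
  have reach: "reach v" if "v \<in> V" for v
  proof -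
    have "(adj E)\<^sup>*\<^sup>* p0 v" using conn p0 P(2) that by blast
    moreover have "reach p0"
      unfolding reach_def using p0 idS memA isom_subgroup_id[OF G(1)]
      by (intro bexI[of _ id] bexI[of _ p0]) auto
    ultimately show ?thesis
    proof (induction rule: rtranclp_induct)
      case (step u w)
      then obtain h p where h: "h \<in> G" "p \<in> P" "h p = u" "\<forall>b\<in>B. \<forall>c\<in>B. M h b c \<in> A"
        by (auto simp: reach_def)
      have n: "inv h w \<in> N" using adj[of p h w] h step by auto
      then have "h (inv h w) \<in> V" using G(2) h N(3) by blast
      then have "w \<in> V" using isom_subgroup_simps(5)[OF G(1) h(1)] by simp
      then show ?case using reach_step h n by blast
    qed
  qed
  \<comment> \<open>Some \<open>h\<close> with entries in \<open>A\<close> satisfies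
    \<open>h p = g p0\<close>. Then \<open>inv h \<circ> g\<close> sends \<open>p0\<close> to
    \<open>p\<close>, so it lies in \<open>S\<close>, and \<open>g\<close> is the product of the
    two.\<close>
  have entries: "M g b c \<in> A" if g: "g \<in> G" and bc: "b \<in> B" "c \<in> B" for g b c
  proof -
    have "g p0 \<in> V" using G(2) g p0 P(2) by blast
    then obtain h p where h: "h \<in> G" "p \<in> P" "h p = g p0" "\<forall>b\<in>B. \<forall>c\<in>B. M h b c \<in> A"
      using reach unfolding reach_def by blast
    note i = isom_subgroup_simps[OF G(1) h(1)]
    have "(inv h \<circ> g) p0 = p" using h i by (metis comp_apply)
    then have "inv h \<circ> g \<in> S"
      using i g isom_subgroup_comp[OF G(1)] p0 h(2) N(2) unfolding S_def by blast
    then have "M (h \<circ> (inv h \<circ> g)) b c \<in> A"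
      using h(4) bc
      by (intro entries_comp[OF h(1) isom_subgroup_comp[OF G(1) i(2) g]]) (blast intro: memA)+
    then show ?thesis using i(3) by (simp add: comp_assoc[symmetric])
  qed
  \<comment> \<open>Making the product of all nonzero differences a unit modulo \<open>I\<close>
    keeps each factor out of \<open>I\<close>, so distinct elements of \<open>F\<close> stay
    distinct modulo \<open>I\<close>.\<close>
  define F' where "F' = (\<lambda>(x, y). x - y) ` (F \<times> F) - {0}"
  have finF': "finite F'" unfolding F'_def using finF by auto
  have F'A: "F' \<subseteq> A" unfolding F'_def using A(1) by (auto intro: diff_mem)
  have "prod (\<lambda>x. x) F' \<noteq> 0" using finF' by (simp add: F'_def)
  moreover have "prod (\<lambda>x. x) F' \<in> A" using F'A by (intro prod_mem) auto
  ultimately obtain I e where I: "finite_index_ideal A I" "e \<in> A" "prod (\<lambda>x. x) F' * e - 1 \<in> I"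
    using A(2) unfolding units_survive_def by blast
  interpret I: finite_index_ideal A I by (fact I)
  have F'I: "x \<notin> I" if "x \<in> F'" for x
  proof
    assume x: "x \<in> I"
    have "prod (\<lambda>x. x) F' = x * prod (\<lambda>x. x) (F' - {x})" using finF' that by (rule prod.remove)
    moreover have "prod (\<lambda>x. x) (F' - {x}) \<in> A" using F'A by (intro prod_mem) auto
    ultimately have "prod (\<lambda>x. x) F' * e \<in> I" using x I(2) by (auto intro: I.ideal_mult')
    from I.ideal_diff[OF this I(3)] I.one_notin show False by simp
  qed
  define R where "R g h \<longleftrightarrow> (\<forall>b\<in>B. \<forall>c\<in>B. M g b c - M h b c \<in> I)" for g h
  obtain K where K: "finite K" "K \<subseteq> A" "\<And>a. a \<in> A \<Longrightarrow> \<exists>r\<in>K. a - r \<in> I"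
    using I.finite_quotient by blast
  define \<rho> where "\<rho> a = (SOME r. r \<in> K \<and> a - r \<in> I)" for a
  have \<rho>: "\<rho> a \<in> K" "a - \<rho> a \<in> I" if "a \<in> A" for a
  proof -
    have "\<exists>r. r \<in> K \<and> a - r \<in> I" using K(3)[OF that] by blast
    from someI_ex[OF this] show "\<rho> a \<in> K" "a - \<rho> a \<in> I" by (auto simp: \<rho>_def)
  qed
  \<comment> \<open>\<open>lab g\<close> is the table of residues of the entries of
    \<open>g\<close>. There are finitely many tables, and \<open>Q\<close> will realise all that
    occur.\<close>
  define lab where "lab g = (\<lambda>x\<in>B \<times> B. \<rho> (M g (fst x) (snd x)))" for g
  have "lab ` G \<subseteq> (B \<times> B) \<rightarrow>\<^sub>E K" 
  proof (rule image_subsetI)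
    fix g assume "g \<in> G"
    then show "lab g \<in> (B \<times> B) \<rightarrow>\<^sub>E K"
      unfolding lab_def restrict_PiE_iff by (intro ballI \<rho>(1) entries) (simp_all add: mem_Times_iff)
  qed
  then have "finite (lab ` G)"
    by (rule finite_subset) (intro finite_PiE finite_cartesian_product finB K(1))
  from finite_subset_image[OF this order_refl] obtain Q where
    Q: "Q \<subseteq> G" "finite Q" "lab ` G = lab ` Q" by blast
  have labR: "R g h" if gh: "g \<in> G" "h \<in> G" and lab: "lab g = lab h" for g h
    unfolding R_def
  proof (intro ballI)
    fix b c assume bc: "b \<in> B" "c \<in> B"
    have "lab g (b, c) = lab h (b, c)" using lab by simp
    then have "\<rho> (M g b c) = \<rho> (M h b c)" using bc by (simp add: lab_def)
    then show "M g b c - M h b c \<in> I"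
      using I.ideal_diff[OF \<rho>(2)[OF entries[OF gh(1) bc]] \<rho>(2)[OF entries[OF gh(2) bc]]] by simp
  qed
  have "group_congruence G R Q"
  proof
    show "isom_subgroup G" by fact
    show "R g g" for g by (simp add: R_def I.ideal_zero)
    show "R h g" if "R g h" for g h
      unfolding R_def
    proof (intro ballI)
      fix b c assume "b \<in> B" "c \<in> B"
      then have "- (M g b c - M h b c) \<in> I" using that by (intro I.ideal_uminus) (simp add: R_def)
      then show "M h b c - M g b c \<in> I" by simp
    qed
    show "R g k" if "R g h" "R h k" for g h k
      unfolding R_def
    proof (intro ballI)
      fix b c assume "b \<in> B" "c \<in> B"
      then have "M g b c - M h b c + (M h b c - M k b c) \<in> I"
        using that by (intro I.ideal_add) (auto simp: R_def)
      then show "M g b c - M k b c \<in> I" by simp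
    qed
    show "R (g \<circ> h) (g' \<circ> h')" if "g \<in> G" "g' \<in> G" "h \<in> G" "h' \<in> G" "R g g'" "R h h'" for g g' h h'
      unfolding R_def
    proof (intro ballI)
      fix b c assume bc: "b \<in> B" "c \<in> B"
      have "(\<Sum>d\<in>B. M g b d * M h d c - M g' b d * M h' d c) \<in> I"
        using that bc entries by (intro I.ideal_sum I.cong_mult) (auto simp: R_def)
      then show "M (g \<circ> h) b c - M (g' \<circ> h') b c \<in> I"
        using that bc by (simp add: M_comp sum_subtractf)
    qed
    show "finite Q" "Q \<subseteq> G" by fact+
    show "\<exists>q\<in>Q. R g q" if "g \<in> G" for g
    proof -
      have "lab g \<in> lab ` Q" using Q(3) that by blast
      then obtain q where q: "q \<in> Q" "lab g = lab q" by blast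
      then have "R g q" using Q(1) by (intro labR[OF that]) auto
      with q show ?thesis by blast
    qed
  qed
  moreover have "t x = x" if t: "t \<in> G" "R t id" "p \<in> P" "t p \<in> N" and x: "x \<in> V" for t p x
  proof -
    have tS: "t \<in> S" using t by (auto simp: S_def)
    \<comment> \<open>Both \<open>t\<close> and \<open>id\<close> lie in \<open>S\<close>, so these
      entries belong to \<open>F\<close>, where congruence modulo \<open>I\<close> means
      equality.\<close>
    have eq: "M t b c = M id b c" if "b \<in> B" "c \<in> B" for b c
    proof (rule ccontr)
      assume "M t b c \<noteq> M id b c"
      then have "M t b c - M id b c \<in> F'"
        using memF[OF tS that] memF[OF idS that] by (auto simp: F'_def)
      then show False using F'I t(2) that by (auto simp: R_def)
    qed
    have "t \<in> isom_H2" using t GH by blast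
    then obtain L where L: "linear L" "\<And>z. z \<in> hdisc \<Longrightarrow> L (?X z) = ?X (t z)"
      using isom_H2_linear by blast
    have LB: "L c = id c" if c: "c \<in> B" for c
    proof -
      have "?X (t (q c)) = ?X (id (q c))"
        using expand[OF t(1) c] expand[OF isom_subgroup_id[OF G(1)] c] eq[OF _ c] by simp
      then show ?thesis using L(2)[of "q c"] q[OF c] V(2) by auto
    qed
    have "L (?X x) = id (?X x)"
      by (rule linear_eq_on_span[OF L(1) linear_id LB sp[OF x]])
    then have "?X (t x) = ?X x" using L(2) x V(2) by auto
    then show "t x = x" using x V(2) G(2)[OF t(1) x] by (intro hyperboloid_inj) auto
  qed
  ultimately show ?thesis by blast
qed

section \<open>Colouring the vertices by orbits of the congruence subgroup\<close>

theorem theorem4p4: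
  fixes V :: "complex set" and E :: "complex set set"
    and \<gamma> :: "complex set \<Rightarrow> real \<Rightarrow> complex"
    and G :: "(complex \<Rightarrow> complex) set"
  assumes "hyp_map V E \<gamma>"
    and "graph_locally_finite V E"
    and "one_ended V E"
    and "locally_finite_points V"
    and "isom_subgroup G"
    and "acts_on_map G V E \<gamma>"
    and "quasi_transitive G V"
  shows "\<exists>m::nat. m > 0 \<and> (\<exists>C. proper_colouring V E m C \<and>
           (\<exists>T. finite_index_subgroup T G \<and> (\<forall>t\<in>T. \<forall>x\<in>V. C (t x) = C x)))"
proof -
  have V: "V \<subseteq> hdisc" "V \<noteq> {}" "simple_graph V E" "graph_connected V E"
    using assms(1) by (auto simp: hyp_map_def)
  have edge: "u \<in> V \<and> v \<in> V \<and> u \<noteq> v" if "{u, v} \<in> E" for u v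
  proof -
    obtain a b where "{u, v} = {a, b}" "a \<in> V" "b \<in> V" "a \<noteq> b"
      using V(3) \<open>{u, v} \<in> E\<close> unfolding simple_graph_def by blast
    then show ?thesis by (auto simp: doubleton_eq_iff)
  qed
  have GV: "g v \<in> V" if "g \<in> G" "v \<in> V" for g v
    using assms(6) that unfolding acts_on_map_def by blast
  have GE: "{g u, g v} \<in> E" if "g \<in> G" "{u, v} \<in> E" for g u v
    using assms(6) that edge[OF that(2)] unfolding acts_on_map_def by blast
  note i = isom_subgroup_simps[OF assms(5)]
  from finite_orbit_representatives[OF assms(7,5)] obtain P where
    P: "finite P" "P \<subseteq> V" "\<forall>v\<in>V. \<exists>p\<in>P. \<exists>g\<in>G. g p = v"
    by (elim exE conjE)
  define N where "N = P \<union> (\<Union>p\<in>P. {u. {u, p} \<in> E})"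
  have N: "finite N" "P \<subseteq> N" "N \<subseteq> V"
    using P(1,2) assms(2) edge by (auto simp: N_def graph_locally_finite_def)
  have adjN: "inv g v \<in> N" if "p \<in> P" "g \<in> G" "adj E (g p) v" for p g v
  proof -
    have "{inv g v, inv g (g p)} \<in> E"
      using that GE[OF i(2), of g v "g p"] by (auto simp: adj_def insert_commute)
    then show ?thesis using that i(6)[OF that(2)] by (auto simp: N_def)
  qed
  have conn: "(adj E)\<^sup>*\<^sup>* u v" if "u \<in> V" "v \<in> V" for u v
    using V(4) that by (auto simp: graph_connected_def)
  have sep: "\<exists>R Q. group_congruence G R Q \<and>
      (\<forall>t\<in>G. R t id \<longrightarrow> (\<exists>p\<in>P. t p \<in> N) \<longrightarrow> (\<forall>x\<in>V. t x = x))"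
    by (rule separating_congruence[of V G P N E]) (fact assms V GV P N conn adjN bspec[OF P(3)])+
  obtain R Q where R: "group_congruence G R Q"
    "\<And>t p x. t \<in> G \<Longrightarrow> R t id \<Longrightarrow> p \<in> P \<Longrightarrow> t p \<in> N \<Longrightarrow> x \<in> V \<Longrightarrow> t x = x"
    using sep by blast
  interpret group_congruence G R Q by (fact R(1))
  note T = isom_subgroup_simps[OF isom_subgroup_kernel] isom_subgroup_comp[OF isom_subgroup_kernel]
  define orb where "orb x = (\<lambda>t. t x) ` kernel" for x
  have self: "x \<in> orb x" for x
    unfolding orb_def using isom_subgroup_id[OF isom_subgroup_kernel] by (intro image_eqI[of _ _ id]) auto
  have orb_sub: "orb (t x) \<subseteq> orb x" if "t \<in> kernel" for t x
  proof
    fix y assume "y \<in> orb (t x)"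
    then obtain s where "s \<in> kernel" "y = s (t x)" by (auto simp: orb_def)
    then show "y \<in> orb x" unfolding orb_def
      using T(7)[of s t] that by (intro image_eqI[of _ _ "s \<circ> t"]) auto
  qed
  have orb: "orb (t x) = orb x" if "t \<in> kernel" for t x
    using orb_sub[OF that, of x] orb_sub[OF T(2)[OF that], of "t x"] T(6)[OF that] by auto
  \<comment> \<open>For \<open>v = g p\<close> with \<open>g\<close> congruent to \<open>h\<close>
    in \<open>Q\<close>, the kernel element \<open>g \<circ> inv h\<close> carries
    \<open>h p\<close> to \<open>v\<close>; hence there are finitely many orbits.\<close>
  have "orb ` V \<subseteq> (\<lambda>(q, p). orb (q p)) ` (Q \<times> P)"
  proof (rule image_subsetI)
    fix v assume "v \<in> V"
    then obtain p g where p: "p \<in> P" "g \<in> G" "g p = v" using P(3) by blast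
    obtain h where h: "h \<in> Q" "R g h" using Q(3) p(2) by blast
    then have hG: "h \<in> G" using Q(2) by blast
    have "orb ((g \<circ> inv h) (h p)) = orb (h p)"
      using div_mem_kernel(2)[OF p(2) hG h(2)] by (rule orb)
    then have "orb v = orb (h p)" using i(6)[OF hG] p(3) by simp
    then show "orb v \<in> (\<lambda>(q, p). orb (q p)) ` (Q \<times> P)" using h p by force
  qed
  then have "finite (orb ` V)" using Q(1) P(1) by (meson finite_SigmaI finite_imageI finite_subset)
  from finite_imp_inj_to_nat_seg[OF this] obtain f :: "complex set \<Rightarrow> nat" and n where
    f: "f ` orb ` V = {i. i < n}" "inj_on f (orb ` V)"
    by (elim exE conjE)
  \<comment> \<open>The numbering \<open>f\<close> of the orbits starts at 0, the colours at
    1.\<close>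
  define C where "C x = Suc (f (orb x))" for x
  have n: "f (orb x) < n" if "x \<in> V" for x using f(1) that by blast
  have "proper_colouring V E n C"
    unfolding proper_colouring_def
  proof (intro conjI ballI impI)
    show "C ` V \<subseteq> {1..n}" using n by (auto simp: C_def Suc_le_eq)
    fix u v assume uv: "u \<in> V" "v \<in> V" "{u, v} \<in> E"
    show "C u \<noteq> C v"
    proof
      assume "C u = C v"
      then have "orb u = orb v" using f(2) uv by (auto simp: C_def inj_on_def)
      then have "u \<in> orb v" using self[of u] by simp
      then obtain t where t: "t \<in> kernel" "u = t v" by (auto simp: orb_def)
      obtain p g where g: "p \<in> P" "g \<in> G" "g p = v" using P(3) uv(2) by blast
      \<comment> \<open>This conjugate carries \<open>p\<close> to \<open>inv g u\<close>, a
        neighbour of \<open>p\<close> and so in \<open>N\<close>. The separation property then gives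
        \<open>s p = p\<close>, that is \<open>u = v\<close>.\<close>
      define s where "s = inv g \<circ> t \<circ> g"
      have s: "s \<in> kernel" unfolding s_def using conj_mem_kernel g t by blast
      have "s p \<in> N" using adjN[OF g(1,2), of u] uv(3) g t by (auto simp: s_def adj_def insert_commute)
      then have "s p = p" using R(2)[of s p p] s g(1) P(2) by (auto simp: kernel_def)
      then have "g (inv g u) = g p" using g(3) t(2) by (simp add: s_def)
      then have "u = v" using i(5)[OF g(2)] g(3) by simp
      then show False using edge[OF uv(3)] by simp
    qed
  qed
  moreover have "n > 0" using n V(2) by (metis all_not_in_conv gr0I less_zeroE)
  moreover have "\<forall>t\<in>kernel. \<forall>x\<in>V. C (t x) = C x" by (simp add: C_def orb)
  ultimately show ?thesis using finite_index_kernel by blast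
qed

end
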